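(* Let $A_2\in\mathbf{C}^{n\times n}$, $B_2\in\mathbf{C}^{n\times m}$ be the coefficients of the antilinear system $x(k+1)=A_2^{\#}x^{\#}(k)+B_2^{\#}u^{\#}(k)$, and let $Q\in\mathbf{C}^{n\times n}$, $R\in\mathbf{C}^{m\times m}$ be positive definite (Hermitian). Define $$\begin{aligned}A_N&=A_2^{\#}\left(I_n-B_2\left(R+B_2^{\mathrm H}Q^{\#}B_2\right)^{-1}B_2^{\mathrm H}Q^{\#}\right)A_2,\qquad B_N=\begin{bmatrix}B_2^{\#}&A_2^{\#}B_2\end{bmatrix},\\ Q_N&=Q+A_2^{\mathrm H}\left(Q^{-\#}+B_2R^{-1}B_2^{\mathrm H}\right)^{-1}A_2,\qquad R_N=\begin{bmatrix}R^{\#}&0\\0&R+B_2^{\mathrm H}Q^{\#}B_2\end{bmatrix}.\end{aligned}$$ Then the following three statements are equivalent: 1. The bimatrix Riccati equation $$-\{Q,0\}=\{0,A_2\}^{\mathrm H}\{P_1,P_2\}\{0,A_2\}-\{P_1,P_2\}-\{0,A_2\}^{\mathrm H}\{P_1,P_2\}\{0,B_2\}\{S_1,S_2\}^{-1}\{0,B_2\}^{\mathrm H}\{P_1,P_2\}\{0,A_2\},$$ with $\{S_1,S_2\}=\{R,0\}+\{0,B_2\}^{\mathrm H}\{P_1,P_2\}\{0,B_2\}$, has a unique positive definite solution $\{P_1,P_2\}$. 2. The anti-Riccati equation $$-Q=A_2^{\mathrm H}P_A^{\#}A_2-A_2^{\mathrm H}P_A^{\#}B_2\left(R+B_2^{\mathrm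 H}P_A^{\#}B_2\right)^{-1}B_2^{\mathrm H}P_A^{\#}A_2-P_A$$ has a unique positive definite solution $P_A$. 3. The normal Riccati equation $$-Q_N=A_N^{\mathrm H}P_NA_N-P_N-A_N^{\mathrm H}P_NB_N\left(R_N+B_N^{\mathrm H}P_NB_N\right)^{-1}B_N^{\mathrm H}P_NA_N$$ has a unique positive definite solution $P_N$. Moreover, these solutions satisfy $P_2=0$ and $P_1=P_A=P_N$.
   Context: For a complex matrix $M$, $M^{\#}$, $M^{\mathrm T}$, $M^{\mathrm H}$ denote its (entrywise) conjugate, transpose and conjugate transpose, and $M^{-\#}=(M^{-1})^{\#}=(M^{\#})^{-1}$. Positive definite matrices are Hermitian. Bimatrices. For $M_1,M_2\in\mathbf{C}^{p\times q}$ the bimatrix $\{M_1,M_2\}$ is the real-linear map $\mathbf{C}^q\to\mathbf{C}^p$, $\{M_1,M_2\}x=M_1x+M_2^{\#}x^{\#}$. Addition is componentwise. The product is composition: $\{M_1,M_2\}\{N_1,N_2\}=\{M_1N_1+M_2^{\#}N_2,\;M_2N_1+M_1^{\#}N_2\}$. The identity is $\{I,0\}$, and the inverse is taken with respect to this product. The conjugate transpose is $\{M_1,M_2\}^{\mathrm H}=\{M_1^{\mathrm H},M_2^{\mathrm T}\}$. A bimatrix $\{P_1,P_2\}$ with $P_i\in\mathbf{C}^{n\times n}$ is positive definite if $\{P_1,P_2\}^{\mathrm H}=\{P_1,P_2\}$ and $\operatorname{Re}(x^{\mathrm H}\{P_1,P_2\}x)>0$ for all nonzero $x\in\mathbf{C}^n$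 (equivalently, $\begin{bmatrix}P_1&P_2^{\#}\\P_2&P_1^{\#}\end{bmatrix}$ is positive definite). *)

theory Defs
  imports "HOL-Analysis.Analysis"
begin

definition vconj :: "complex^'n \<Rightarrow> complex^'n"
  where "vconj x = (\<chi> i. cnj (x $ i))"

definition mconj :: "complex^'q^'p \<Rightarrow> complex^'q^'p"  ("_\<^sup>\<sharp>" [1000] 999)
  where "M\<^sup>\<sharp> = map_matrix cnj M"

definition mherm :: "complex^'q^'p \<Rightarrow> complex^'p^'q"  ("_\<^sup>H" [1000] 999)
  where "M\<^sup>H = map_matrix cnj (transpose M)"

text \<open>\<^term>\<open>cinner x y\<close> is the scalar \<open>x\<^sup>H y\<close>, conjugate-linear in the first argument.\<close>

definition cinner :: "complex^'n \<Rightarrow> complex^'n \<Rightarrow> complex"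
  where "cinner x y = (\<Sum>i\<in>UNIV. cnj (x $ i) * y $ i)"

text \<open>For Hermitian \<open>M\<close> the scalar \<open>x\<^sup>H M x\<close> is real, so taking the real part loses nothing.\<close>

definition posdef :: "complex^'n^'n \<Rightarrow> bool"
  where "posdef M \<longleftrightarrow> M\<^sup>H = M \<and> (\<forall>x. x \<noteq> 0 \<longrightarrow> Re (cinner x (M *v x)) > 0)"

text \<open>
  A bimatrix is represented by its pair of coefficient matrices, so that sum, difference and
  negation are the componentwise operations on pairs.  The real-linear map it stands for
  is \<open>bm_apply\<close>.
\<close>

type_synonym ('q, 'p) bimatrix = "(complex^'q^'p) \<times> (complex^'q^'p)"

definition bm_apply :: "('q::finite, 'p::finite) bimatrix \<Rightarrow> complex^'q \<Rightarrow> complex^'p"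
  where "bm_apply M x = fst M *v x + (snd M)\<^sup>\<sharp> *v vconj x"

definition bm_mult ::
    "('q::finite, 'p::finite) bimatrix \<Rightarrow> ('r::finite, 'q) bimatrix \<Rightarrow> ('r, 'p) bimatrix"
    (infixl "\<odot>" 70)
  where "M \<odot> N =
    (fst M ** fst N + (snd M)\<^sup>\<sharp> ** snd N, snd M ** fst N + (fst M)\<^sup>\<sharp> ** snd N)"

definition bm_one :: "('n::finite, 'n) bimatrix"
  where "bm_one = (mat 1, 0)"

text \<open>As with \<^const>\<open>matrix_inv\<close>, the value is meaningful only if an inverse exists.\<close>

definition bm_inv :: "('n::finite, 'n) bimatrix \<Rightarrow> ('n, 'n) bimatrix"
  where "bm_inv M = (SOME N. M \<odot> N = bm_one \<and> N \<odot> M = bm_one)"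

definition bm_herm :: "('q::finite, 'p::finite) bimatrix \<Rightarrow> ('p, 'q) bimatrix"
  where "bm_herm M = ((fst M)\<^sup>H, transpose (snd M))"

definition bm_posdef :: "('n::finite, 'n) bimatrix \<Rightarrow> bool"
  where "bm_posdef P \<longleftrightarrow>
    bm_herm P = P \<and> (\<forall>x. x \<noteq> 0 \<longrightarrow> Re (cinner x (bm_apply P x)) > 0)"

text \<open>Block matrices \<open>[M N]\<close> and \<open>[M 0; 0 N]\<close>; \<open>Inl\<close> indexes the first block, \<open>Inr\<close> the second.\<close>

definition block_row :: "complex^'a^'p \<Rightarrow> complex^'b^'p \<Rightarrow> complex^('a + 'b)^'p"
  where "block_row M N = (\<chi> i j. case j of Inl k \<Rightarrow> M $ i $ k | Inr k \<Rightarrow> N $ i $ k)"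

definition block_diag ::
    "complex^'a^'c \<Rightarrow> complex^'b^'d \<Rightarrow> complex^('a + 'b)^('c + 'd)"
  where "block_diag M N = (\<chi> i j. case (i, j) of
      (Inl k, Inl l) \<Rightarrow> M $ k $ l
    | (Inr k, Inr l) \<Rightarrow> N $ k $ l
    | _ \<Rightarrow> 0)"

text \<open>Discrete-time Riccati equations; in each of them the unknown is the last argument.\<close>

definition bm_riccati ::
    "('n::finite, 'n) bimatrix \<Rightarrow> ('m::finite, 'n) bimatrix \<Rightarrow> ('n, 'n) bimatrix \<Rightarrow>
     ('m, 'm) bimatrix \<Rightarrow> ('n, 'n) bimatrix \<Rightarrow> bool"
  where "bm_riccati A B Q R P \<longleftrightarrow>
    - Q = bm_herm A \<odot> P \<odot> A - P
      - bm_herm A \<odot> P \<odot> B \<odot> bm_inv (R + bm_herm B \<odot> P \<odot> B) \<odot> bm_herm B \<odot> P \<odot> A"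

definition anti_riccati ::
    "complex^'n^'n \<Rightarrow> complex^'m^'n \<Rightarrow> complex^'n^'n \<Rightarrow> complex^'m^'m \<Rightarrow> complex^'n^'n \<Rightarrow> bool"
  where "anti_riccati A B Q R P \<longleftrightarrow>
    - Q = A\<^sup>H ** P\<^sup>\<sharp> ** A
      - A\<^sup>H ** P\<^sup>\<sharp> ** B ** matrix_inv (R + B\<^sup>H ** P\<^sup>\<sharp> ** B) ** B\<^sup>H ** P\<^sup>\<sharp> ** A - P"

definition riccati ::
    "complex^'n^'n \<Rightarrow> complex^'m^'n \<Rightarrow> complex^'n^'n \<Rightarrow> complex^'m^'m \<Rightarrow> complex^'n^'n \<Rightarrow> bool"
  where "riccati A B Q R P \<longleftrightarrow>
    - Q = A\<^sup>H ** P ** A - P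
      - A\<^sup>H ** P ** B ** matrix_inv (R + B\<^sup>H ** P ** B) ** B\<^sup>H ** P ** A"

lemma mconj_mconj [simp]: "(M\<^sup>\<sharp>)\<^sup>\<sharp> = M"
  by (simp add: mconj_def vec_eq_iff)

lemma vconj_add: "vconj (x + y) = vconj x + vconj y"
  by (simp add: vconj_def vec_eq_iff)

lemma vconj_mult: "vconj (M *v x) = M\<^sup>\<sharp> *v vconj x"
  by (simp add: vconj_def mconj_def vec_eq_iff matrix_vector_mult_def)

lemma vconj_vconj [simp]: "vconj (vconj x) = x"
  by (simp add: vconj_def vec_eq_iff)

lemma mconj_add: "(M + N)\<^sup>\<sharp> = M\<^sup>\<sharp> + N\<^sup>\<sharp>"
  by (simp add: mconj_def vec_eq_iff)

lemma mconj_mult: "(M ** N)\<^sup>\<sharp> = M\<^sup>\<sharp> ** N\<^sup>\<sharp>"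
  by (simp add: mconj_def vec_eq_iff matrix_matrix_mult_def)

lemma bm_apply_mult: "bm_apply (M \<odot> N) x = bm_apply M (bm_apply N x)"
  by (simp add: bm_apply_def bm_mult_def vconj_add vconj_mult mconj_add mconj_mult
      matrix_vector_right_distrib matrix_vector_mult_add_rdistrib
      matrix_vector_mul_assoc algebra_simps)

lemma bm_apply_one: "bm_apply bm_one x = x"
  by (simp add: bm_apply_def bm_one_def mconj_def map_matrix_def matrix_vector_mult_def
      vec_eq_iff mat_def if_distrib [of "\<lambda>c. c * _"] cong: if_cong)

end

theory Submission
  imports Defs
begin

text \<open>
  Completing the square shows that a Riccati map \<open>F\<close> sends the quadratic form \<open>p\<close> of a positive
  definite bimatrix to the form \<open>x \<mapsto> min\<^sub>u (q x + r u + p (A x + B u))\<close>, where \<open>q\<close> and \<open>r\<close> are the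
  forms of \<open>Q\<close> and \<open>R\<close>.  If \<open>p\<close> and \<open>p'\<close> are both fixed by \<open>F\<close> and \<open>t\<close> is the maximum of \<open>p / p'\<close> on
  the unit sphere, then \<open>p \<le> t p' - (t - 1) q\<close> when \<open>t > 1\<close>, which contradicts the choice of \<open>t\<close>; hence \<open>F\<close> has
  at most one positive definite fixed point.  All three equations are fixed point equations of
  this kind for bimatrices, and the normal one belongs to \<open>F \<circ> F\<close>, where \<open>F\<close> is the map of the
  antilinear system: it describes two time steps at once.  A fixed point \<open>P\<close> of \<open>F \<circ> F\<close> is one of
  \<open>F\<close>, because \<open>F P\<close> is fixed by \<open>F \<circ> F\<close> too.
\<close>

section \<open>Bimatrices as real-linear maps on a real inner product space\<close>

text \<open>Links the definitions of positive definiteness to the Euclidean inner product of the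
  underlying real vector space, for which bimatrices are linear maps.\<close>

lemma Re_cinner: "Re (cinner x y) = x \<bullet> y"
  by (simp add: cinner_def inner_vec_def inner_complex_def)

lemma inner_vconj: "vconj x \<bullet> vconj y = x \<bullet> y"
  by (simp add: vconj_def inner_vec_def inner_complex_def)

lemma vconj_scaleR: "vconj (c *\<^sub>R x) = c *\<^sub>R vconj x"
  by (simp add: vconj_def vec_eq_iff)

lemma mconj_mherm: "(M\<^sup>\<sharp>)\<^sup>H = transpose M" "(M\<^sup>H)\<^sup>\<sharp> = transpose M" "(transpose M)\<^sup>\<sharp> = M\<^sup>H"
  by (simp_all add: mconj_def mherm_def transpose_def vec_eq_iff)

lemma mconj_0 [simp]: "0\<^sup>\<sharp> = 0"
  by (simp add: mconj_def vec_eq_iff)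

lemma transpose_0 [simp]: "transpose 0 = 0"
  by (simp add: transpose_def vec_eq_iff)

lemma mconj_diff: "(M - N)\<^sup>\<sharp> = M\<^sup>\<sharp> - N\<^sup>\<sharp>"
  by (simp add: mconj_def vec_eq_iff)

lemma mconj_scaleR: "(c *\<^sub>R M)\<^sup>\<sharp> = c *\<^sub>R M\<^sup>\<sharp>"
  by (simp add: mconj_def vec_eq_iff)

lemma mherm_mherm [simp]: "(M\<^sup>H)\<^sup>H = M"
  by (simp add: mherm_def transpose_def vec_eq_iff)

lemma inner_mherm: "x \<bullet> (M *v y) = (M\<^sup>H *v x) \<bullet> y"
proof -
  have "cinner x (M *v y) = (\<Sum>i\<in>UNIV. \<Sum>j\<in>UNIV. cnj (x $ i) * (M $ i $ j * y $ j))"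
    by (simp add: cinner_def matrix_vector_mult_def sum_distrib_left)
  also have "\<dots> = (\<Sum>j\<in>UNIV. \<Sum>i\<in>UNIV. cnj (x $ i) * (M $ i $ j * y $ j))"
    by (rule sum.swap)
  also have "\<dots> = cinner (M\<^sup>H *v x) y"
    by (simp add: cinner_def matrix_vector_mult_def mherm_def transpose_def sum_distrib_left sum_distrib_right mult_ac)
  finally show ?thesis
    by (simp flip: Re_cinner)
qed

lemma bm_apply_add: "bm_apply M (x + y) = bm_apply M x + bm_apply M y"
  by (simp add: bm_apply_def vconj_add matrix_vector_right_distrib)

lemma bm_apply_scaleR: "bm_apply M (c *\<^sub>R x) = c *\<^sub>R bm_apply M x"
  by (simp add: bm_apply_def vconj_scaleR matrix_vector_mult_def vec_eq_iff scaleR_sum_right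
      algebra_simps scaleR_right_distrib)

lemma linear_bm_apply: "linear (bm_apply M)"
  by (intro linearI bm_apply_add bm_apply_scaleR)

lemma bm_apply_add_left: "bm_apply (M + N) x = bm_apply M x + bm_apply N x"
  by (simp add: bm_apply_def mconj_add matrix_vector_mult_add_rdistrib)

lemma bm_apply_diff_left: "bm_apply (M - N) x = bm_apply M x - bm_apply N x"
  by (simp add: bm_apply_def mconj_diff matrix_vector_mult_diff_rdistrib)

lemma bm_apply_0_left [simp]: "bm_apply 0 x = 0"
  by (simp add: bm_apply_def)

lemma bm_apply_matrix: "bm_apply (M, 0) x = M *v x"
  by (simp add: bm_apply_def)

text \<open>Multiplication by \<open>\<i>\<close> commutes with the linear part and anticommutes
  with the antilinear part.\<close>

lemma bm_apply_imaginary: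
  "bm_apply (M\<^sub>1, M\<^sub>2) (\<i> *s x) = \<i> *s bm_apply (M\<^sub>1, - M\<^sub>2) x"
  by (simp add: bm_apply_def vconj_def mconj_def matrix_vector_mult_def vec_eq_iff
      sum_distrib_left algebra_simps flip: sum_negf)

text \<open>Testing the difference at \<open>x\<close> and at \<open>\<i> *s x\<close> separates its
  linear from its antilinear part, so both vanish. Algebraic laws for bimatrices can therefore be
  checked by evaluating maps.\<close>

lemma bm_eqI:
  assumes "\<And>x. bm_apply M x = bm_apply N x"
  shows "M = N"
proof -
  obtain D\<^sub>1 D\<^sub>2 where D: "M - N = (D\<^sub>1, D\<^sub>2)" by fastforce
  have zero: "bm_apply (D\<^sub>1, D\<^sub>2) x = 0" for x
    using assms by (simp flip: D add: bm_apply_diff_left)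
  have minus: "bm_apply (D\<^sub>1, - D\<^sub>2) x = 0" for x
    using zero[of "\<i> *s x"] by (simp add: bm_apply_imaginary vec_eq_iff)
  have conj: "D\<^sub>2\<^sup>\<sharp> *v vconj x = D\<^sub>1 *v x" "D\<^sub>2\<^sup>\<sharp> *v vconj x = - (D\<^sub>1 *v x)" for x
  proof -
    have "(- D\<^sub>2)\<^sup>\<sharp> = - (D\<^sub>2\<^sup>\<sharp>)"
      using mconj_diff[of 0 D\<^sub>2] by simp
    then show "D\<^sub>2\<^sup>\<sharp> *v vconj x = D\<^sub>1 *v x" "D\<^sub>2\<^sup>\<sharp> *v vconj x = - (D\<^sub>1 *v x)"
      using zero[of x] minus[of x] matrix_vector_mult_diff_rdistrib[of 0 "D\<^sub>2\<^sup>\<sharp>" "vconj x"]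
      by (auto simp: bm_apply_def add_eq_0_iff)
  qed
  have "D\<^sub>1 *v x = 0" for x
    using conj[of x] by (simp add: vec_eq_iff)
  then have "D\<^sub>1 = 0"
    by (simp add: matrix_eq)
  moreover have "D\<^sub>2\<^sup>\<sharp> *v x = 0" for x
    using conj(1)[of "vconj x"] \<open>D\<^sub>1 = 0\<close> by simp
  then have "D\<^sub>2\<^sup>\<sharp> = 0"
    by (simp add: matrix_eq)
  then have "D\<^sub>2 = 0"
    by (metis mconj_0 mconj_mconj)
  ultimately have "M - N = 0"
    by (simp add: D zero_prod_def)
  then show ?thesis by simp
qed

lemma bm_mult_assoc: "M \<odot> N \<odot> L = M \<odot> (N \<odot> L)"
  by (rule bm_eqI) (simp add: bm_apply_mult)

lemma bm_mult_one [simp]: "M \<odot> bm_one = M" "bm_one \<odot> M = M"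
  by (rule bm_eqI, simp add: bm_apply_mult bm_apply_one)+

text \<open>\<open>bm_herm\<close> is the adjoint for the real inner product. Conjugating both
  arguments preserves that product, which turns the adjoint of the antilinear part into a plain
  transpose.\<close>

lemma inner_bm_herm: "x \<bullet> bm_apply M y = bm_apply (bm_herm M) x \<bullet> y"
proof -
  have "x \<bullet> ((snd M)\<^sup>\<sharp> *v vconj y) = (transpose (snd M) *v x) \<bullet> vconj y"
    by (simp add: inner_mherm mconj_mherm)
  also have "\<dots> = ((transpose (snd M))\<^sup>\<sharp> *v vconj x) \<bullet> y"
    by (metis inner_vconj vconj_mult vconj_vconj)
  finally show ?thesis
    by (simp add: bm_apply_def bm_herm_def inner_add inner_mherm)
qed

lemma bm_herm_eqI:
  assumes "\<And>x y. x \<bullet> bm_apply M y = bm_apply N x \<bullet> y"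
  shows "bm_herm M = N"
  using assms by (intro bm_eqI) (metis inner_bm_herm inner_commute vector_eq_rdot)

lemma bm_herm_herm [simp]: "bm_herm (bm_herm M) = M"
  by (simp add: bm_herm_def)

lemma bm_herm_mult: "bm_herm (M \<odot> N) = bm_herm N \<odot> bm_herm M"
  by (rule bm_herm_eqI) (simp add: bm_apply_mult inner_bm_herm)

lemma bm_herm_add: "bm_herm (M + N) = bm_herm M + bm_herm N"
  by (rule bm_herm_eqI) (simp add: bm_apply_add_left inner_bm_herm inner_add)

lemma bm_herm_diff: "bm_herm (M - N) = bm_herm M - bm_herm N"
  by (rule bm_herm_eqI) (simp add: bm_apply_diff_left inner_bm_herm inner_diff)

lemma bm_herm_one [simp]: "bm_herm bm_one = bm_one"
  by (rule bm_herm_eqI) (simp add: bm_apply_one)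

section \<open>Quadratic forms and inverses of positive definite bimatrices\<close>

definition qform :: "('n::finite, 'n) bimatrix \<Rightarrow> complex^'n \<Rightarrow> real"
  where "qform M x = x \<bullet> bm_apply M x"

lemma qform_add:
  assumes "bm_herm M = M"
  shows "qform M (x + y) = qform M x + qform M y + 2 * (y \<bullet> bm_apply M x)"
  using inner_bm_herm[of y M x] assms
  by (simp add: qform_def bm_apply_add inner_add inner_commute)

lemma qform_scaleR: "qform M (c *\<^sub>R x) = c\<^sup>2 * qform M x"
  by (simp add: qform_def bm_apply_scaleR power2_eq_square)

lemma qform_0_right [simp]: "qform M 0 = 0"
  by (simp add: qform_def)

lemma continuous_on_qform: "continuous_on X (qform M)"
  unfolding qform_def[abs_def]
  by (intro continuous_intros linear_continuous_on) 
     (simp add: linear_bm_apply linear_conv_bounded_linear[symmetric])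

lemma qform_add_left: "qform (M + N) x = qform M x + qform N x"
  by (simp add: qform_def bm_apply_add_left inner_add)

text \<open>By polarization a quadratic form determines its self-adjoint map. Identities between
  Riccati maps thus reduce to identities between costs.\<close>

lemma qform_eqD:
  assumes "bm_herm M = M" "bm_herm N = N" and eq: "\<And>x. qform M x = qform N x"
  shows "M = N"
proof (rule bm_eqI)
  fix x
  have "y \<bullet> bm_apply M x = y \<bullet> bm_apply N x" for y
    using qform_add[OF assms(1), of x y] qform_add[OF assms(2), of x y] eq by simp
  then show "bm_apply M x = bm_apply N x"
    by (metis vector_eq_rdot inner_commute)
qed

lemma bm_posdef_qform:
  "bm_posdef M \<longleftrightarrow> bm_herm M = M \<and> (\<forall>x. x \<noteq> 0 \<longrightarrow> qform M x > 0)"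
  by (simp add: bm_posdef_def qform_def Re_cinner)

lemma qform_nonneg: "bm_posdef M \<Longrightarrow> qform M x \<ge> 0"
  by (cases "x = 0") (auto simp: bm_posdef_qform qform_def less_imp_le)

text \<open>Left multiplication by a positive definite bimatrix is an injective real-linear map of the
  finite-dimensional space of bimatrices, hence surjective.\<close>

lemma bm_inv_posdef:
  assumes "bm_posdef (S :: ('n::finite, 'n) bimatrix)"
  shows "S \<odot> bm_inv S = bm_one" "bm_inv S \<odot> S = bm_one"
proof -
  have herm: "bm_herm S = S" and pos: "x \<noteq> 0 \<Longrightarrow> qform S x > 0" for x
    using assms by (auto simp: bm_posdef_qform)
  have lin: "linear (\<lambda>N :: ('n, 'n) bimatrix. S \<odot> N)"
  proof (intro linearI)
    fix M N :: "('n, 'n) bimatrix" and c :: real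
    show "S \<odot> (M + N) = S \<odot> M + S \<odot> N"
      by (rule bm_eqI) (simp add: bm_apply_mult bm_apply_add_left bm_apply_add)
    have "bm_apply (c *\<^sub>R L) x = c *\<^sub>R bm_apply L x" for L :: "('n, 'n) bimatrix" and x
      by (simp add: bm_apply_def mconj_scaleR matrix_vector_mult_def vec_eq_iff scaleR_sum_right
          scaleR_right_distrib)
    then show "S \<odot> (c *\<^sub>R N) = c *\<^sub>R (S \<odot> N)"
      by (intro bm_eqI) (simp add: bm_apply_mult bm_apply_scaleR)
  qed
  have "N = 0" if "S \<odot> N = 0" for N :: "('n, 'n) bimatrix"
  proof (rule bm_eqI)
    fix x
    have "bm_apply S (bm_apply N x) = 0"
      by (simp add: that flip: bm_apply_mult)
    then have "qform S (bm_apply N x) = 0"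
      by (simp add: qform_def)
    then show "bm_apply N x = bm_apply 0 x"
      using pos[of "bm_apply N x"] by (cases "bm_apply N x = 0") auto
  qed
  then have "inj (\<lambda>N :: ('n, 'n) bimatrix. S \<odot> N)"
    by (simp add: linear_injective_0[OF lin])
  then have "surj (\<lambda>N :: ('n, 'n) bimatrix. S \<odot> N)"
    by (rule linear_injective_imp_surjective[OF lin]) (rule refl)
  then obtain N where N: "S \<odot> N = bm_one"
    unfolding surj_def by metis
  \<comment> \<open>Since \<open>S\<close> is self-adjoint, the adjoint of a right inverse is a left
    inverse, and the two must coincide.\<close>
  have left: "bm_herm N \<odot> S = bm_one"
    using arg_cong[OF N, of bm_herm] by (simp add: bm_herm_mult herm)
  have "bm_herm N = bm_herm N \<odot> (S \<odot> N)"
    by (simp add: N)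
  also have "\<dots> = N"
    by (simp add: left flip: bm_mult_assoc)
  finally have "S \<odot> N = bm_one \<and> N \<odot> S = bm_one"
    using N left by simp
  from someI[of "\<lambda>N. S \<odot> N = bm_one \<and> N \<odot> S = bm_one", OF this]
  show "S \<odot> bm_inv S = bm_one" "bm_inv S \<odot> S = bm_one"
    by (auto simp: bm_inv_def)
qed

lemma bm_inv_unique:
  assumes "bm_posdef S" "S \<odot> N = bm_one"
  shows "bm_inv S = N"
proof -
  have "bm_inv S = bm_inv S \<odot> (S \<odot> N)"
    by (simp add: assms(2))
  also have "\<dots> = N"
    by (simp add: bm_inv_posdef(2)[OF assms(1)] flip: bm_mult_assoc)
  finally show ?thesis .
qed

lemma bm_herm_inv:
  assumes "bm_posdef S"
  shows "bm_herm (bm_inv S) = bm_inv S"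
proof -
  have herm: "bm_herm S = S"
    using assms by (simp add: bm_posdef_def)
  have "S \<odot> bm_herm (bm_inv S) = bm_one"
    using arg_cong[OF bm_inv_posdef(2)[OF assms], of bm_herm] unfolding bm_herm_mult herm bm_herm_one .
  then show ?thesis
    by (rule bm_inv_unique[OF assms, symmetric])
qed

section \<open>The Riccati map as a minimization over inputs\<close>

text \<open>The Riccati equation solved for its isolated \<open>P\<close>: solutions become fixed
  points of a map that can be composed with itself.\<close>

definition bm_ric ::
    "('n::finite, 'n) bimatrix \<Rightarrow> ('m::finite, 'n) bimatrix \<Rightarrow> ('n, 'n) bimatrix \<Rightarrow>
     ('m, 'm) bimatrix \<Rightarrow> ('n, 'n) bimatrix \<Rightarrow> ('n, 'n) bimatrix"
  where "bm_ric A B Q R P = Q + bm_herm A \<odot> P \<odot> A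
      - bm_herm A \<odot> P \<odot> B \<odot> bm_inv (R + bm_herm B \<odot> P \<odot> B) \<odot> bm_herm B \<odot> P \<odot> A"

lemma bm_riccati_iff: "bm_riccati A B Q R P \<longleftrightarrow> bm_ric A B Q R P = P"
  unfolding bm_riccati_def bm_ric_def by (auto simp: algebra_simps)

lemma qform_congruence: "qform (bm_herm B \<odot> P \<odot> B) u = qform P (bm_apply B u)"
  by (simp add: qform_def bm_apply_mult inner_bm_herm)

text \<open>The congruence term contributes a nonnegative form and \<open>R\<close> supplies
  strictness. This makes the \<open>bm_inv\<close> inside the Riccati map a genuine inverse.\<close>

lemma bm_posdef_congruence:
  assumes "bm_posdef P" "bm_posdef R"
  shows "bm_posdef (R + bm_herm B \<odot> P \<odot> B)"
  using assms qform_nonneg[OF assms(1)]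
  by (auto simp: bm_posdef_qform bm_herm_add bm_herm_mult bm_mult_assoc[symmetric]
      qform_add_left qform_congruence intro: add_pos_nonneg)

text \<open>The optimal feedback up to sign: the minimizing input at \<open>x\<close> is
  \<open>- bm_apply (bm_gain A B R P) x\<close>.\<close>

definition bm_gain ::
    "('n::finite, 'n) bimatrix \<Rightarrow> ('m::finite, 'n) bimatrix \<Rightarrow>
     ('m, 'm) bimatrix \<Rightarrow> ('n, 'n) bimatrix \<Rightarrow> ('n, 'm) bimatrix"
  where "bm_gain A B R P =
    bm_inv (R + bm_herm B \<odot> P \<odot> B) \<odot> bm_herm B \<odot> P \<odot> A"

text \<open>Completing the square in \<open>u\<close>: the quadratic part is the form of
  \<open>S\<close>, the cross term is \<open>2 * (u \<bullet> t)\<close>, and shifting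
  \<open>u\<close> by \<open>k\<close>, the solution of \<open>S k = t\<close>, absorbs it. The
  remainder \<open>- (t \<bullet> k)\<close> is the subtracted term of the Riccati map.\<close>

lemma bm_ric_square:
  assumes P: "bm_posdef P" and R: "bm_posdef R"
  shows "qform Q x + qform R u + qform P (bm_apply A x + bm_apply B u) =
    qform (bm_ric A B Q R P) x +
    qform (R + bm_herm B \<odot> P \<odot> B) (u + bm_apply (bm_gain A B R P) x)"
proof -
  define S where "S = R + bm_herm B \<odot> P \<odot> B"
  define t where "t = bm_apply (bm_herm B \<odot> P \<odot> A) x"
  define k where "k = bm_apply (bm_gain A B R P) x"
  have S: "bm_posdef S"
    unfolding S_def by (rule bm_posdef_congruence[OF P R])
  have hS: "bm_herm S = S" and hP: "bm_herm P = P"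
    using S P by (auto simp: bm_posdef_def)
  have k: "k = bm_apply (bm_inv S) t"
    by (simp add: k_def t_def bm_gain_def S_def bm_apply_mult)
  have Sk: "bm_apply S k = t"
    by (simp add: k bm_inv_posdef(1)[OF S] bm_apply_one flip: bm_apply_mult)
  have "x \<bullet> bm_apply (bm_herm A \<odot> P \<odot> B \<odot> bm_inv S \<odot> bm_herm B \<odot> P \<odot> A) x
      = t \<bullet> bm_apply (bm_inv S) t"
    by (simp add: t_def bm_apply_mult inner_bm_herm hP)
  then have ric: "qform (bm_ric A B Q R P) x = qform Q x + qform P (bm_apply A x) - t \<bullet> k"
    unfolding k
    by (simp add: bm_ric_def qform_def bm_apply_add_left bm_apply_diff_left inner_add inner_diff
        flip: S_def)
       (simp add: bm_apply_mult inner_bm_herm)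
  have "qform S (u + k) = qform S u + t \<bullet> k + 2 * (u \<bullet> t)"
    using qform_add[OF hS, of k u] Sk by (simp add: add.commute qform_def inner_commute)
  also have "qform S u = qform R u + qform P (bm_apply B u)"
    by (simp add: S_def qform_add_left qform_congruence)
  finally have sq: "qform S (u + k) = qform R u + qform P (bm_apply B u) + t \<bullet> k + 2 * (u \<bullet> t)" .
  have "bm_apply B u \<bullet> bm_apply P (bm_apply A x) = u \<bullet> t"
    by (simp add: t_def bm_apply_mult inner_bm_herm)
  then have "qform P (bm_apply A x + bm_apply B u)
      = qform P (bm_apply A x) + qform P (bm_apply B u) + 2 * (u \<bullet> t)"
    using qform_add[OF hP, of "bm_apply A x" "bm_apply B u"] by simp
  with ric sq show ?thesis
    unfolding S_def k_def by simp
qed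

text \<open>The completed square is nonnegative, so any trial input bounds the value from
  above.\<close>

lemma bm_ric_le:
  assumes P: "bm_posdef P" and R: "bm_posdef R"
  shows "qform (bm_ric A B Q R P) x
    \<le> qform Q x + qform R u + qform P (bm_apply A x + bm_apply B u)"
  using bm_ric_square[OF P R] qform_nonneg[OF bm_posdef_congruence[OF P R]] by simp

text \<open>The feedback input \<open>- bm_apply (bm_gain A B R P) x\<close> makes the square
  vanish.\<close>

lemma bm_ric_attained:
  assumes P: "bm_posdef P" and R: "bm_posdef R"
  obtains u where "qform (bm_ric A B Q R P) x
    = qform Q x + qform R u + qform P (bm_apply A x + bm_apply B u)"
  using bm_ric_square[OF P R, of Q x "- bm_apply (bm_gain A B R P) x" A B]
  by (intro that[of "- bm_apply (bm_gain A B R P) x"]) simp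

text \<open>At the optimal input the value is a sum of costs in which the term of \<open>Q\<close>
  is positive for nonzero \<open>x\<close> and the others are nonnegative. Self-adjointness comes
  from that of the inverse.\<close>

lemma bm_posdef_ric:
  assumes P: "bm_posdef P" and R: "bm_posdef R" and Q: "bm_posdef Q"
  shows "bm_posdef (bm_ric A B Q R P)"
proof -
  have "qform (bm_ric A B Q R P) x > 0" if "x \<noteq> 0" for x
  proof -
    obtain u where "qform (bm_ric A B Q R P) x
        = qform Q x + qform R u + qform P (bm_apply A x + bm_apply B u)"
      using bm_ric_attained[OF P R] .
    moreover have "qform Q x > 0"
      using Q that by (simp add: bm_posdef_qform)
    ultimately show ?thesis
      using qform_nonneg[OF R, of u] qform_nonneg[OF P, of "bm_apply A x + bm_apply B u"] by linarith
  qed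
  moreover have "bm_herm (bm_ric A B Q R P) = bm_ric A B Q R P"
    using P Q bm_herm_inv[OF bm_posdef_congruence[OF P R]]
    by (simp add: bm_ric_def bm_herm_add bm_herm_diff bm_herm_mult bm_posdef_def flip: bm_mult_assoc)
  ultimately show ?thesis
    by (simp add: bm_posdef_qform)
qed

section \<open>Uniqueness of positive definite fixed points\<close>

text \<open>Compare the two value functions at a point of the unit sphere where their quotient is
  largest: if that quotient exceeded 1, one Bellman step would make it strictly smaller.\<close>

lemma Bellman_solution_le:
  fixes p p' q :: "'a::euclidean_space \<Rightarrow> real" and r :: "'b \<Rightarrow> real" and f :: "'a \<Rightarrow> 'b \<Rightarrow> 'a"
  assumes cont: "continuous_on (sphere 0 1) p" "continuous_on (sphere 0 1) p'"
    and hom: "\<And>c x. p (c *\<^sub>R x) = c\<^sup>2 * p x" "\<And>c x. p' (c *\<^sub>R x) = c\<^sup>2 * p' x"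
    and pos: "\<And>x. x \<noteq> 0 \<Longrightarrow> p' x > 0" "\<And>x. x \<noteq> 0 \<Longrightarrow> q x > 0" "\<And>u. r u \<ge> 0"
    and le: "\<And>x u. p x \<le> q x + r u + p (f x u)"
    and att: "\<And>x. \<exists>u. p' x = q x + r u + p' (f x u)"
  shows "p x \<le> p' x"
proof -
  have pos_sphere: "p' x > 0" if "x \<in> sphere 0 1" for x
    using that by (intro pos) auto
  have "continuous_on (sphere 0 1) (\<lambda>x. p x / p' x)"
    using pos_sphere by (intro continuous_intros cont) force
  moreover have "sphere (0 :: 'a) 1 \<noteq> {}" by simp
  ultimately obtain x\<^sub>0 where x\<^sub>0: "x\<^sub>0 \<in> sphere 0 1"
    and max: "\<And>y. y \<in> sphere 0 1 \<Longrightarrow> p y / p' y \<le> p x\<^sub>0 / p' x\<^sub>0"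
    using continuous_attains_sup[OF compact_sphere, of "0 :: 'a" 1 "\<lambda>x. p x / p' x"] by blast
  define t where "t = p x\<^sub>0 / p' x\<^sub>0"
  have zero: "p 0 = 0" "p' 0 = 0"
    using hom[of 0 0] by auto
  \<comment> \<open>Homogeneity of degree 2 extends the bound from the sphere to the whole
    space.\<close>
  have scaled: "p y \<le> t * p' y" for y
  proof (cases "y = 0")
    case False
    define z where "z = y /\<^sub>R norm y"
    have y: "y = norm y *\<^sub>R z" and z: "z \<in> sphere 0 1"
      using False by (auto simp: z_def)
    have "p z \<le> t * p' z"
      using max[OF z] pos_sphere[OF z] by (simp add: t_def pos_divide_le_eq)
    then have "(norm y)\<^sup>2 * p z \<le> t * ((norm y)\<^sup>2 * p' z)"
      using mult_left_mono[of "p z" "t * p' z" "(norm y)\<^sup>2"] by (simp add: mult.left_commute)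
    then show ?thesis
      using hom(1)[of "norm y" z] hom(2)[of "norm y" z] by (simp flip: y)
  qed (simp add: zero)
  have "t \<le> 1"
  proof (rule ccontr)
    assume t: "\<not> t \<le> 1"
    \<comment> \<open>The input optimal for \<open>p'\<close> is a trial input for \<open>p\<close>.
      Since \<open>q + r\<close> is positive at this pair, replacing it by
      \<open>t * (q + r)\<close> is a strict increase, giving \<open>p < t * p'\<close> at a point
      where equality holds by definition of \<open>t\<close>.\<close>
    obtain u where u: "p' x\<^sub>0 = q x\<^sub>0 + r u + p' (f x\<^sub>0 u)"
      using att by blast
    have "q x\<^sub>0 + r u > 0"
      using pos(2)[of x\<^sub>0] pos(3)[of u] x\<^sub>0 by (metis add_pos_nonneg norm_zero mem_sphere_0 zero_neq_one)
    then have "q x\<^sub>0 + r u < t * (q x\<^sub>0 + r u)"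
      using t by simp
    moreover have "p x\<^sub>0 \<le> q x\<^sub>0 + r u + t * p' (f x\<^sub>0 u)"
      using le[of x\<^sub>0 u] scaled[of "f x\<^sub>0 u"] by simp
    ultimately have "p x\<^sub>0 < t * p' x\<^sub>0"
      unfolding u by (simp add: algebra_simps)
    then show False
      using pos_sphere[OF x\<^sub>0] by (simp add: t_def)
  qed
  then have "t * p' x \<le> 1 * p' x"
    using pos(1)[of x] zero by (intro mult_right_mono) (cases "x = 0"; auto simp: less_imp_le)+
  then show ?thesis
    using scaled[of x] by simp
qed

lemma bm_ric_fixpoint_le:
  assumes Q: "bm_posdef Q" and R: "bm_posdef R"
    and P: "bm_posdef P" "bm_ric A B Q R P = P"
    and P': "bm_posdef P'" "bm_ric A B Q R P' = P'"
  shows "qform P x \<le> qform P' x"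
proof (rule Bellman_solution_le[where f = "\<lambda>x u. bm_apply A x + bm_apply B u"
      and q = "qform Q" and r = "qform R"])
  show "qform P x \<le> qform Q x + qform R u + qform P (bm_apply A x + bm_apply B u)" for x u
    using bm_ric_le[OF P(1) R, of A B Q] P(2) by simp
  show "\<exists>u. qform P' x = qform Q x + qform R u + qform P' (bm_apply A x + bm_apply B u)" for x
    using bm_ric_attained[OF P'(1) R, of A B Q x] P'(2) by metis
qed (use P' Q R in \<open>auto simp: continuous_on_qform qform_scaleR qform_nonneg bm_posdef_qform\<close>)

lemma bm_ric_fixpoint_unique:
  assumes "bm_posdef Q" "bm_posdef R"
    and "bm_posdef P" "bm_ric A B Q R P = P"
    and "bm_posdef P'" "bm_ric A B Q R P' = P'"
  shows "P = P'"
proof (rule qform_eqD)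
  show "bm_herm P = P" "bm_herm P' = P'"
    using assms(3,5) by (simp_all only: bm_posdef_def)
  show "qform P x = qform P' x" for x
    by (rule antisym[OF bm_ric_fixpoint_le[OF assms] bm_ric_fixpoint_le[OF assms(1,2,5,6,3,4)]])
qed

section \<open>Ordinary matrices as bimatrices with zero second component\<close>

lemma bm_mult_matrix: "(M, 0) \<odot> (N, 0) = (M ** N, 0)"
  by (simp add: bm_mult_def)

lemma bm_herm_matrix: "bm_herm (M, 0) = (M\<^sup>H, 0)"
  by (simp add: bm_herm_def)

lemma bm_posdef_matrix: "bm_posdef (M, 0) \<longleftrightarrow> posdef M"
  by (simp add: bm_posdef_def posdef_def bm_herm_matrix bm_apply_matrix)

lemma matrix_inv_eqI:
  fixes M N :: "'a::field^'n^'n"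
  assumes "M ** N = mat 1"
  shows "matrix_inv M = N"
proof -
  have NM: "N ** M = mat 1"
    using assms by (simp add: matrix_left_right_inverse)
  with assms have "\<exists>L. M ** L = mat 1 \<and> L ** M = mat 1"
    by blast
  from someI_ex[OF this] have "M ** matrix_inv M = mat 1"
    by (simp add: matrix_inv_def)
  then have "N ** M ** matrix_inv M = N"
    by (simp flip: matrix_mul_assoc)
  then show ?thesis
    by (simp add: NM)
qed

text \<open>The first component of \<open>S \<odot> bm_inv S = bm_one\<close> provides a right
  inverse of \<open>M\<close>, which is two-sided for square matrices.\<close>

lemma posdef_inverse:
  assumes "posdef M"
  shows "M ** matrix_inv M = mat 1" "matrix_inv M ** M = mat 1"
proof -
  obtain N\<^sub>1 N\<^sub>2 where N: "bm_inv (M, 0) = (N\<^sub>1, N\<^sub>2)" by fastforce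
  have "M ** N\<^sub>1 = mat 1"
    using bm_inv_posdef(1)[of "(M, 0)"] assms
    by (simp add: N bm_posdef_matrix bm_mult_def bm_one_def)
  then show "M ** matrix_inv M = mat 1" "matrix_inv M ** M = mat 1"
    by (simp_all add: matrix_inv_eqI matrix_left_right_inverse)
qed

lemma bm_inv_matrix:
  assumes "posdef M"
  shows "bm_inv (M, 0) = (matrix_inv M, 0)"
  using assms
  by (intro bm_inv_unique) (simp_all add: bm_posdef_matrix bm_mult_matrix posdef_inverse bm_one_def)

lemma posdef_congruence:
  assumes "posdef P" "posdef R"
  shows "posdef (R + B\<^sup>H ** P ** B)"
  using bm_posdef_congruence[of "(P, 0)" "(R, 0)" "(B, 0)"] assms
  by (simp add: bm_posdef_matrix bm_herm_matrix bm_mult_matrix)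

lemma bm_ric_matrix:
  assumes "posdef P" "posdef R"
  shows "bm_ric (A, 0) (B, 0) (Q, 0) (R, 0) (P, 0) =
    (Q + A\<^sup>H ** P ** A
      - A\<^sup>H ** P ** B ** matrix_inv (R + B\<^sup>H ** P ** B) ** B\<^sup>H ** P ** A, 0)"
  using bm_inv_matrix[OF posdef_congruence[OF assms]]
  by (simp add: bm_ric_def bm_herm_matrix bm_mult_matrix)

lemma riccati_iff_bm_ric:
  assumes "posdef P" "posdef R"
  shows "riccati A B Q R P \<longleftrightarrow> bm_ric (A, 0) (B, 0) (Q, 0) (R, 0) (P, 0) = (P, 0)"
  unfolding bm_ric_matrix[OF assms] riccati_def by (auto simp: algebra_simps)

lemma qform_mconj: "qform (M\<^sup>\<sharp>, 0) x = qform (M, 0) (vconj x)"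
  by (metis bm_apply_matrix inner_vconj mconj_mconj qform_def vconj_mult)

lemma vconj_0 [simp]: "vconj 0 = 0"
  by (simp add: vconj_def vec_eq_iff)

lemma posdef_mconj:
  assumes "posdef M"
  shows "posdef (M\<^sup>\<sharp>)"
proof -
  have "qform (M\<^sup>\<sharp>, 0) x > 0" if "x \<noteq> 0" for x
  proof -
    have "vconj x \<noteq> 0"
      using that by (metis vconj_0 vconj_vconj)
    with assms show ?thesis
      by (simp add: qform_mconj bm_posdef_qform flip: bm_posdef_matrix)
  qed
  moreover have "M\<^sup>H = M"
    using assms by (simp add: posdef_def)
  then have "(M\<^sup>\<sharp>)\<^sup>H = M\<^sup>\<sharp>"
    by (metis mconj_mconj mconj_mherm(1,2))
  ultimately show ?thesis
    by (simp add: bm_posdef_qform bm_herm_matrix flip: bm_posdef_matrix)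
qed

text \<open>Between two antilinear factors a matrix is conjugated and the product is linear again.
  One step of the antilinear system is thus a linear Riccati step from
  \<open>P\<^sup>\<sharp>\<close>.\<close>

lemma bm_ric_antilinear:
  "bm_ric (0, A) (0, B) Q R (P, 0) = bm_ric (A, 0) (B, 0) Q R (P\<^sup>\<sharp>, 0)"
proof -
  have mult: "bm_herm (0, M) \<odot> (P, 0) \<odot> (0, N) = bm_herm (M, 0) \<odot> (P\<^sup>\<sharp>, 0) \<odot> (N, 0)"
    for M :: "complex^'c^'a" and N :: "complex^'d^'a"
    by (simp add: bm_mult_def bm_herm_def mconj_mult mconj_mherm)
  \<comment> \<open>Rebracketing exposes the triple products on both sides of the inverse, to which
    \<open>mult\<close> applies.\<close>
  have left: "bm_herm (0, M) \<odot> (P, 0) \<odot> (0, B) \<odot> L \<odot> bm_herm (0, B) \<odot> (P, 0) \<odot> (0, M) =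
      (bm_herm (0, M) \<odot> (P, 0) \<odot> (0, B)) \<odot> L \<odot> (bm_herm (0, B) \<odot> (P, 0) \<odot> (0, M))"
    for M :: "complex^'c^'a" and L
    by (simp add: bm_mult_assoc)
  show ?thesis
    unfolding bm_ric_def left unfolding mult by (simp add: bm_mult_assoc)
qed

lemma anti_riccati_iff_bm_ric:
  assumes "posdef P" "posdef R"
  shows "anti_riccati A B Q R P \<longleftrightarrow> bm_ric (0, A) (0, B) (Q, 0) (R, 0) (P, 0) = (P, 0)"
  unfolding bm_ric_antilinear bm_ric_matrix[OF posdef_mconj[OF assms(1)] assms(2)] anti_riccati_def
  by (auto simp: algebra_simps)

text \<open>With \<open>s\<close> solving \<open>(R + C G B) s = C G x\<close>, the claimed inverse
  maps \<open>x\<close> to \<open>y = G (x - B s)\<close>. Then \<open>G' y = x - B s\<close>, and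
  \<open>R' C y = R' R s = s\<close> restores the missing \<open>B s\<close>.\<close>

lemma Woodbury:
  fixes G G' :: "'a::field^'n^'n" and B :: "'a^'m^'n" and C :: "'a^'n^'m" and R R' S' :: "'a^'m^'m"
  assumes G: "G' ** G = mat 1" and R: "R' ** R = mat 1" and S: "(R + C ** G ** B) ** S' = mat 1"
  shows "matrix_inv (G' + B ** R' ** C) = G - G ** B ** S' ** C ** G" (is "matrix_inv ?M = ?N")
proof -
  have "?M ** ?N = mat 1"
  proof (unfold matrix_eq, intro allI)
    fix x
    define s where "s = S' *v (C *v (G *v x))"
    have G': "G' *v (G *v y) = y" for y
      using G by (simp add: matrix_vector_mul_assoc)
    have R': "R' *v (R *v y) = y" for y
      using R by (simp add: matrix_vector_mul_assoc)
    have "C *v (G *v x) = ((R + C ** G ** B) ** S') *v (C *v (G *v x))"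
      by (simp add: S)
    also have "\<dots> = (R + C ** G ** B) *v s"
      unfolding s_def by (rule matrix_vector_mul_assoc[symmetric])
    also have "\<dots> = R *v s + C *v (G *v (B *v s))"
      by (simp add: matrix_vector_mult_add_rdistrib matrix_vector_mul_assoc[symmetric])
    finally have "C *v (G *v x) - C *v (G *v (B *v s)) = R *v s"
      by simp
    then have RC: "R' *v (C *v (G *v x)) - R' *v (C *v (G *v (B *v s))) = s"
      by (metis R' matrix_vector_mult_diff_distrib)
    have N: "?N *v x = G *v x - G *v (B *v s)"
      by (simp add: s_def matrix_vector_mult_diff_rdistrib matrix_vector_mul_assoc[symmetric])
    have "(?M ** ?N) *v x = ?M *v (G *v x - G *v (B *v s))"
      unfolding N[symmetric] by (rule matrix_vector_mul_assoc[symmetric])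
    also have "\<dots> = x - B *v s + B *v (R' *v (C *v (G *v x)) - R' *v (C *v (G *v (B *v s))))"
      by (simp add: matrix_vector_mult_diff_distrib matrix_vector_mult_add_rdistrib G'
          flip: matrix_vector_mul_assoc)
    also have "\<dots> = mat 1 *v x"
      by (simp add: RC)
    finally show "(?M ** ?N) *v x = mat 1 *v x" .
  qed
  then show ?thesis
    by (rule matrix_inv_eqI)
qed

section \<open>Block vectors and block matrices\<close>

definition vec_upper :: "'a^('b::finite + 'c::finite) \<Rightarrow> 'a^'b"
  where "vec_upper z = (\<chi> i. z $ Inl i)"

definition vec_lower :: "'a^('b::finite + 'c::finite) \<Rightarrow> 'a^'c"
  where "vec_lower z = (\<chi> i. z $ Inr i)"

lemma ex_block_vec: "\<exists>z. vec_upper z = v \<and> vec_lower z = w"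
  by (rule exI[of _ "\<chi> i. case i of Inl k \<Rightarrow> v $ k | Inr k \<Rightarrow> w $ k"])
    (simp add: vec_upper_def vec_lower_def vec_eq_iff)

lemma sum_UNIV_Plus:
  fixes f :: "'a::finite + 'b::finite \<Rightarrow> 'c::comm_monoid_add"
  shows "sum f UNIV = (\<Sum>i\<in>UNIV. f (Inl i)) + (\<Sum>i\<in>UNIV. f (Inr i))"
  by (subst UNIV_Plus_UNIV[symmetric], subst sum.Plus) auto

lemma block_row_mult: "block_row M N *v z = M *v vec_upper z + N *v vec_lower z"
  by (simp add: block_row_def vec_upper_def vec_lower_def matrix_vector_mult_def vec_eq_iff
      sum_UNIV_Plus)

lemma qform_block_diag:
  "qform (block_diag M N, 0) z = qform (M, 0) (vec_upper z) + qform (N, 0) (vec_lower z)"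
  by (simp add: qform_def bm_apply_matrix block_diag_def vec_upper_def vec_lower_def
      inner_vec_def matrix_vector_mult_def sum_UNIV_Plus)

lemma posdef_block_diag:
  assumes "posdef M" "posdef N"
  shows "posdef (block_diag M N)"
proof -
  have "(block_diag M N)\<^sup>H = block_diag (M\<^sup>H) (N\<^sup>H)"
    by (simp add: mherm_def block_diag_def transpose_def vec_eq_iff split: sum.split)
  moreover have "qform (block_diag M N, 0) z > 0" if "z \<noteq> 0" for z
  proof -
    have "vec_upper z \<noteq> 0 \<or> vec_lower z \<noteq> 0"
      using that by (auto simp: vec_upper_def vec_lower_def vec_eq_iff) (metis sum.exhaust)
    with assms qform_nonneg[of "(M, 0)" "vec_upper z"] qform_nonneg[of "(N, 0)" "vec_lower z"]
    show ?thesis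
      by (auto simp: qform_block_diag bm_posdef_qform add_pos_nonneg add_nonneg_pos
          simp flip: bm_posdef_matrix)
  qed
  moreover have "M\<^sup>H = M" "N\<^sup>H = N"
    using assms by (simp_all only: posdef_def)
  ultimately show ?thesis
    by (simp add: bm_posdef_qform bm_herm_matrix flip: bm_posdef_matrix)
qed

section \<open>Two steps of the antilinear system as one linear step\<close>

text \<open>The gain substitution \<open>u = w - K x\<close> removes the cross term from the cost of the first of two
  steps of the antilinear system, and conjugating the second input makes the dynamics linear.\<close>

lemma bm_ric_antilinear_twice:
  fixes A :: "complex^'n^'n" and B :: "complex^'m^'n"
    and Q :: "complex^'n^'n" and R :: "complex^'m^'m"
  defines "S \<equiv> R + B\<^sup>H ** Q\<^sup>\<sharp> ** B"
  defines "K \<equiv> matrix_inv S ** B\<^sup>H ** Q\<^sup>\<sharp>"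
  defines "Q' \<equiv> Q + A\<^sup>H ** matrix_inv ((matrix_inv Q)\<^sup>\<sharp> + B ** matrix_inv R ** B\<^sup>H) ** A"
    and "R' \<equiv> block_diag (R\<^sup>\<sharp>) S"
    and "A' \<equiv> A\<^sup>\<sharp> ** (mat 1 - B ** K) ** A"
    and "B' \<equiv> block_row (B\<^sup>\<sharp>) (A\<^sup>\<sharp> ** B)"
  assumes Q: "posdef Q" and R: "posdef R"
  shows "posdef Q'" and "posdef R'"
    and "bm_posdef P \<Longrightarrow> bm_ric (A', 0) (B', 0) (Q', 0) (R', 0) P =
      bm_ric (0, A) (0, B) (Q, 0) (R, 0) (bm_ric (0, A) (0, B) (Q, 0) (R, 0) P)"
proof -
  have G: "posdef (Q\<^sup>\<sharp>)"
    by (rule posdef_mconj[OF Q])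
  have S: "posdef S"
    unfolding S_def by (rule posdef_congruence[OF G R])
  have inv: "(matrix_inv Q)\<^sup>\<sharp> ** Q\<^sup>\<sharp> = mat 1"
    by (simp add: posdef_inverse[OF Q] flip: mconj_mult) (simp add: mconj_def mat_def vec_eq_iff)
  \<comment> \<open>The bracket in \<open>Q'\<close> is expanded by \<open>Woodbury\<close> with
    \<open>G = Q\<^sup>\<sharp>\<close>, which brings it to the shape of a Riccati map.\<close>
  have "matrix_inv ((matrix_inv Q)\<^sup>\<sharp> + B ** matrix_inv R ** B\<^sup>H) =
      Q\<^sup>\<sharp> - Q\<^sup>\<sharp> ** B ** matrix_inv S ** B\<^sup>H ** Q\<^sup>\<sharp>"
    by (rule Woodbury[OF inv posdef_inverse(2)[OF R]]) (simp add: posdef_inverse[OF S] flip: S_def)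
  then have "Q' = Q + A\<^sup>H ** Q\<^sup>\<sharp> ** A - A\<^sup>H ** Q\<^sup>\<sharp> ** B ** matrix_inv S ** B\<^sup>H ** Q\<^sup>\<sharp> ** A"
    unfolding Q'_def matrix_eq
    by (simp add: matrix_vector_mult_diff_distrib matrix_vector_mult_add_rdistrib
        matrix_vector_mult_diff_rdistrib flip: matrix_vector_mul_assoc)
  \<comment> \<open>So the form of \<open>Q'\<close> is the least cost of the present state, the
    first input and the next state, the latter being conjugated and hence weighted by
    \<open>Q\<^sup>\<sharp>\<close>.\<close>
  then have Q'_ric: "(Q', 0) = bm_ric (A, 0) (B, 0) (Q, 0) (R, 0) (Q\<^sup>\<sharp>, 0)"
    by (simp add: bm_ric_matrix[OF G R] S_def)
  show Q': "posdef Q'"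
    using bm_posdef_ric[of "(Q\<^sup>\<sharp>, 0)" "(R, 0)" "(Q, 0)" "(A, 0)" "(B, 0)"] G Q R
    by (simp add: bm_posdef_matrix flip: Q'_ric)
  show R': "posdef R'"
    unfolding R'_def by (rule posdef_block_diag[OF posdef_mconj[OF R] S])
  have gain: "bm_gain (A, 0) (B, 0) (R, 0) (Q\<^sup>\<sharp>, 0) = (K ** A, 0)"
    by (simp add: bm_gain_def bm_herm_matrix bm_mult_matrix bm_inv_matrix[OF S] K_def flip: S_def)

  define next_state where
    "next_state x u = bm_apply (0, A) x + bm_apply (0, B) u" for x u
  have next_state: "next_state x u = vconj (A *v x + B *v u)" for x u
    by (simp add: next_state_def bm_apply_def vconj_add vconj_mult)
  \<comment> \<open>The first-step cost leaves the square of \<open>u + K A x\<close>, the lower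
    block of \<open>z\<close>, weighted by \<open>S\<close>. The upper block is the conjugate of
    \<open>v\<close>, hence its weight \<open>R\<^sup>\<sharp>\<close>. Two conjugations cancel in
    the state, leaving \<open>A' x + B' z\<close>.\<close>
  have two_step: "qform (Q', 0) x + qform (R', 0) z + qform P (bm_apply (A', 0) x + bm_apply (B', 0) z) =
      qform (Q, 0) x + qform (R, 0) u +
      (qform (Q, 0) (next_state x u) + qform (R, 0) v + qform P (next_state (next_state x u) v))"
    if u: "u = vec_lower z - K *v (A *v x)" and v: "v = vconj (vec_upper z)" for x u v z P
  proof -
    have w: "u + K ** A *v x = vec_lower z"
      by (simp add: u flip: matrix_vector_mul_assoc)
    have "qform (Q, 0) x + qform (R, 0) u + qform (Q\<^sup>\<sharp>, 0) (A *v x + B *v u) =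
        qform (Q', 0) x + qform (S, 0) (vec_lower z)"
      using bm_ric_square[of "(Q\<^sup>\<sharp>, 0)" "(R, 0)" "(Q, 0)" x u "(A, 0)" "(B, 0)"] G R
      by (simp add: gain w bm_posdef_matrix bm_herm_matrix bm_mult_matrix bm_apply_matrix
          flip: Q'_ric S_def)
    moreover have "qform (R', 0) z = qform (R, 0) v + qform (S, 0) (vec_lower z)"
      by (simp add: R'_def qform_block_diag qform_mconj v)
    moreover have "bm_apply (A', 0) x + bm_apply (B', 0) z = next_state (next_state x u) v"
      by (simp add: next_state vconj_add vconj_mult u v bm_apply_matrix A'_def B'_def block_row_mult
          matrix_vector_mult_diff_distrib matrix_vector_right_distrib
          matrix_vector_mult_diff_rdistrib flip: matrix_vector_mul_assoc)
    ultimately show ?thesis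
      by (simp add: qform_mconj next_state)
  qed

  assume P: "bm_posdef P"
  let ?F = "bm_ric (0, A) (0, B) (Q, 0) (R, 0)" and ?N = "bm_ric (A', 0) (B', 0) (Q', 0) (R', 0)"
  have bmQ: "bm_posdef (Q, 0)" and bmR: "bm_posdef (R, 0)"
    and bmQ': "bm_posdef (Q', 0)" and bmR': "bm_posdef (R', 0)"
    using Q R Q' R' by (simp_all add: bm_posdef_matrix)
  have FP: "bm_posdef (?F P)"
    by (rule bm_posdef_ric[OF P bmR bmQ])
  show "?N P = ?F (?F P)"
  proof (rule qform_eqD)
    show "bm_herm (?N P) = ?N P"
      using bm_posdef_ric[OF P bmR' bmQ'] by (simp only: bm_posdef_def)
    show "bm_herm (?F (?F P)) = ?F (?F P)"
      using bm_posdef_ric[OF FP bmR bmQ] by (simp only: bm_posdef_def)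
    show "qform (?N P) x = qform (?F (?F P)) x" for x
    proof (rule antisym)
      obtain u where u: "qform (?F (?F P)) x =
          qform (Q, 0) x + qform (R, 0) u + qform (?F P) (next_state x u)"
        unfolding next_state_def using bm_ric_attained[OF FP bmR] .
      obtain v where v: "qform (?F P) (next_state x u) = qform (Q, 0) (next_state x u) +
          qform (R, 0) v + qform P (next_state (next_state x u) v)"
        unfolding next_state_def using bm_ric_attained[OF P bmR] .
      \<comment> \<open>The input substitution of \<open>two_step\<close> is invertible: this
        \<open>z\<close> turns the optimal pair \<open>u\<close>, \<open>v\<close> into a trial
        input for the normal system.\<close>
      obtain z where z: "vec_upper z = vconj v" "vec_lower z = u + K *v (A *v x)"
        using ex_block_vec by blast
      show "qform (?N P) x \<le> qform (?F (?F P)) x"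
        using bm_ric_le[OF P bmR', of "(A', 0)" "(B', 0)" "(Q', 0)" x z] two_step[of u z x v P]
        by (simp add: u v z)
    next
      obtain z where z: "qform (?N P) x = qform (Q', 0) x + qform (R', 0) z +
          qform P (bm_apply (A', 0) x + bm_apply (B', 0) z)"
        using bm_ric_attained[OF P bmR'] .
      \<comment> \<open>Conversely the optimal \<open>z\<close> splits into trial inputs for the two
        successive steps.\<close>
      define u where "u = vec_lower z - K *v (A *v x)"
      define v where "v = vconj (vec_upper z)"
      have "qform (?F (?F P)) x \<le> qform (Q, 0) x + qform (R, 0) u + qform (?F P) (next_state x u)"
        unfolding next_state_def by (rule bm_ric_le[OF FP bmR])
      also have "qform (?F P) (next_state x u) \<le> qform (Q, 0) (next_state x u) +
          qform (R, 0) v + qform P (next_state (next_state x u) v)"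
        unfolding next_state_def by (rule bm_ric_le[OF P bmR])
      finally show "qform (?F (?F P)) x \<le> qform (?N P) x"
        using two_step[OF u_def v_def, of P] z by simp
    qed
  qed
qed

section \<open>Vanishing of the antilinear component of a solution\<close>

text \<open>Multiplication by \<open>\<i>\<close> anticommutes with antilinear maps, so the form of \<open>(P\<^sub>1, P\<^sub>2)\<close>
  composed with it, which is the form of \<open>(P\<^sub>1, - P\<^sub>2)\<close>, solves the same Bellman equation.\<close>

lemma bm_ric_antilinear_fixpoint_matrix:
  fixes A P\<^sub>1 P\<^sub>2 Q :: "complex^'n^'n" and B :: "complex^'m^'n" and R :: "complex^'m^'m"
  assumes Q: "bm_posdef (Q, 0)" and R: "bm_posdef (R, 0)"
    and P: "bm_posdef (P\<^sub>1, P\<^sub>2)"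
    and fixpoint: "bm_ric (0, A) (0, B) (Q, 0) (R, 0) (P\<^sub>1, P\<^sub>2) = (P\<^sub>1, P\<^sub>2)"
  shows "P\<^sub>2 = 0"
proof -
  let ?q = "qform (Q, 0)" and ?r = "qform (R, 0)"
  let ?p = "qform (P\<^sub>1, P\<^sub>2)" and ?p' = "qform (P\<^sub>1, - P\<^sub>2)"
  let ?f = "\<lambda>x u. bm_apply (0, A) x + bm_apply (0, B) u"
  have qform_i: "qform (M\<^sub>1, M\<^sub>2) (\<i> *s x) = qform (M\<^sub>1, - M\<^sub>2) x"
    for M\<^sub>1 M\<^sub>2 :: "complex^'k^'k" and x
    by (simp add: qform_def bm_apply_imaginary inner_vec_def inner_complex_def add.commute)
  have qform_minus: "qform M (- x) = qform M x" for M :: "('k::finite, 'k) bimatrix" and x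
    using qform_scaleR[of M "-1" x] by simp
  \<comment> \<open>The sign from conjugating \<open>\<i>\<close> is harmless because quadratic
    forms are even.\<close>
  have f_i: "?f (\<i> *s x) (\<i> *s u) = - (\<i> *s ?f x u)" for x u
    by (simp add: bm_apply_def mconj_def vconj_def vec_eq_iff matrix_vector_mult_def
        sum_distrib_left algebra_simps sum_negf)
  have le: "?p x \<le> ?p' x" for x
  proof (rule Bellman_solution_le[where f = ?f and q = ?q and r = ?r])
    fix x
    show "?p x \<le> ?q x + ?r u + ?p (?f x u)" for u
      using bm_ric_le[OF P R, of "(0, A)" "(0, B)" "(Q, 0)"] by (simp only: fixpoint)
    show "?p' x > 0" if "x \<noteq> 0"
    proof -
      have "\<i> *s x \<noteq> 0"
        using that by (simp add: vec_eq_iff)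
      then show ?thesis
        using P by (simp add: bm_posdef_qform flip: qform_i)
    qed
    obtain v where v: "?p (\<i> *s x) = ?q (\<i> *s x) + ?r v + ?p (?f (\<i> *s x) v)"
      using bm_ric_attained[OF P R, of "(0, A)" "(0, B)" "(Q, 0)" "\<i> *s x"]
      by (metis fixpoint)
    \<comment> \<open>Chosen so that \<open>\<i> *s u = v\<close>: the optimal input for
      \<open>?p\<close> at \<open>\<i> *s x\<close> becomes one for \<open>?p'\<close> at
      \<open>x\<close>.\<close>
    define u where "u = (- \<i>) *s v"
    have "v = \<i> *s u"
      by (simp add: u_def vec_eq_iff flip: mult.assoc)
    with v have "?p' x = ?q x + ?r u + ?p' (?f x u)"
      by (simp only: f_i qform_minus qform_i minus_zero)
    then show "\<exists>u. ?p' x = ?q x + ?r u + ?p' (?f x u)" ..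
  qed (use Q R in \<open>auto simp: continuous_on_qform qform_scaleR qform_nonneg bm_posdef_qform\<close>)
  have "(P\<^sub>1, P\<^sub>2) = (P\<^sub>1, - P\<^sub>2)"
  proof (rule qform_eqD)
    show "bm_herm (P\<^sub>1, P\<^sub>2) = (P\<^sub>1, P\<^sub>2)"
      using P by (simp only: bm_posdef_def)
    then show "bm_herm (P\<^sub>1, - P\<^sub>2) = (P\<^sub>1, - P\<^sub>2)"
      by (simp add: bm_herm_def transpose_def vec_eq_iff)
    \<comment> \<open>\<open>qform_i\<close> exchanges the two forms, so the inequality at
      \<open>\<i> *s x\<close> is the reverse inequality at \<open>x\<close>.\<close>
    show "?p x = ?p' x" for x
      using le[of x] le[of "\<i> *s x"] by (simp add: qform_i)
  qed
  then show ?thesis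
    by (simp add: vec_eq_iff eq_neg_iff_add_eq_0)
qed

section \<open>Comparison of the three solution sets\<close>

theorem theorem4:
  fixes A\<^sub>2 :: "complex^'n^'n" and B\<^sub>2 :: "complex^'m^'n"
    and Q :: "complex^'n^'n" and R :: "complex^'m^'m"
    and A\<^sub>N Q\<^sub>N :: "complex^'n^'n"
    and B\<^sub>N :: "complex^('m + 'm)^'n"
    and R\<^sub>N :: "complex^('m + 'm)^('m + 'm)"
  assumes Q: "posdef Q" and R: "posdef R"
    and A_N: "A\<^sub>N = A\<^sub>2\<^sup>\<sharp> **
      (mat 1 - B\<^sub>2 ** matrix_inv (R + B\<^sub>2\<^sup>H ** Q\<^sup>\<sharp> ** B\<^sub>2) ** B\<^sub>2\<^sup>H ** Q\<^sup>\<sharp>) ** A\<^sub>2"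
    and B_N: "B\<^sub>N = block_row (B\<^sub>2\<^sup>\<sharp>) (A\<^sub>2\<^sup>\<sharp> ** B\<^sub>2)"
    and Q_N: "Q\<^sub>N = Q + A\<^sub>2\<^sup>H **
      matrix_inv ((matrix_inv Q)\<^sup>\<sharp> + B\<^sub>2 ** matrix_inv R ** B\<^sub>2\<^sup>H) ** A\<^sub>2"
    and R_N: "R\<^sub>N = block_diag (R\<^sup>\<sharp>) (R + B\<^sub>2\<^sup>H ** Q\<^sup>\<sharp> ** B\<^sub>2)"
  shows "((\<exists>!P. bm_posdef P \<and> bm_riccati (0, A\<^sub>2) (0, B\<^sub>2) (Q, 0) (R, 0) P) \<longleftrightarrow>
      (\<exists>!P\<^sub>A. posdef P\<^sub>A \<and> anti_riccati A\<^sub>2 B\<^sub>2 Q R P\<^sub>A)) \<and>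
    ((\<exists>!P\<^sub>A. posdef P\<^sub>A \<and> anti_riccati A\<^sub>2 B\<^sub>2 Q R P\<^sub>A) \<longleftrightarrow>
      (\<exists>!P\<^sub>N. posdef P\<^sub>N \<and> riccati A\<^sub>N B\<^sub>N Q\<^sub>N R\<^sub>N P\<^sub>N)) \<and>
    ((\<exists>!P. bm_posdef P \<and> bm_riccati (0, A\<^sub>2) (0, B\<^sub>2) (Q, 0) (R, 0) P) \<longrightarrow>
      (\<forall>P\<^sub>1 P\<^sub>2 P\<^sub>A P\<^sub>N.
        bm_posdef (P\<^sub>1, P\<^sub>2) \<and> bm_riccati (0, A\<^sub>2) (0, B\<^sub>2) (Q, 0) (R, 0) (P\<^sub>1, P\<^sub>2) \<and>
        posdef P\<^sub>A \<and> anti_riccati A\<^sub>2 B\<^sub>2 Q R P\<^sub>A \<and>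
        posdef P\<^sub>N \<and> riccati A\<^sub>N B\<^sub>N Q\<^sub>N R\<^sub>N P\<^sub>N \<longrightarrow>
        P\<^sub>2 = 0 \<and> P\<^sub>1 = P\<^sub>A \<and> P\<^sub>A = P\<^sub>N))"
proof -
  let ?F = "bm_ric (0, A\<^sub>2) (0, B\<^sub>2) (Q, 0) (R, 0)"
  let ?N = "bm_ric (A\<^sub>N, 0) (B\<^sub>N, 0) (Q\<^sub>N, 0) (R\<^sub>N, 0)"
  \<comment> \<open>Reassociated so that the gain \<open>K\<close> of the two-step lemma occurs as a
    single factor.\<close>
  have A\<^sub>N: "A\<^sub>N = A\<^sub>2\<^sup>\<sharp> **
      (mat 1 - B\<^sub>2 ** (matrix_inv (R + B\<^sub>2\<^sup>H ** Q\<^sup>\<sharp> ** B\<^sub>2) ** B\<^sub>2\<^sup>H ** Q\<^sup>\<sharp>)) ** A\<^sub>2"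
    by (simp add: A_N matrix_mul_assoc)
  have Q\<^sub>N: "posdef Q\<^sub>N"
    unfolding Q_N by (rule bm_ric_antilinear_twice(1)[OF Q R])
  have R\<^sub>N: "posdef R\<^sub>N"
    unfolding R_N by (rule bm_ric_antilinear_twice(2)[OF Q R])
  have N: "?N P = ?F (?F P)" if "bm_posdef P" for P
    unfolding A\<^sub>N B_N Q_N R_N by (rule bm_ric_antilinear_twice(3)[OF Q R that])
  have bmQ: "bm_posdef (Q, 0)" "bm_posdef (Q\<^sub>N, 0)" and bmR: "bm_posdef (R, 0)" "bm_posdef (R\<^sub>N, 0)"
    using Q R Q\<^sub>N R\<^sub>N by (simp_all add: bm_posdef_matrix)
  have F_unique: "P = P'"
    if "bm_posdef P" "?F P = P" "bm_posdef P'" "?F P' = P'" for P P'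
    by (rule bm_ric_fixpoint_unique[OF bmQ(1) bmR(1) that])
  have N_unique: "P = P'"
    if "bm_posdef P" "?N P = P" "bm_posdef P'" "?N P' = P'" for P P'
    by (rule bm_ric_fixpoint_unique[OF bmQ(2) bmR(2) that])
  have N_iff_F: "?N P = P \<longleftrightarrow> ?F P = P" if P: "bm_posdef P" for P
  proof
    assume "?F P = P"
    then show "?N P = P"
      by (simp add: N[OF P])
  next
    assume NP: "?N P = P"
    have FP: "bm_posdef (?F P)"
      by (rule bm_posdef_ric[OF P bmR(1) bmQ(1)])
    have "?N (?F P) = ?F P"
      using NP by (simp add: N[OF FP] N[OF P])
    then show "?F P = P"
      by (rule N_unique[OF FP _ P NP])
  qed
  \<comment> \<open>The common description of all three solution sets. It has at most one member, so
    each unique existence claim amounts to \<open>sol\<close> being satisfiable.\<close>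
  define sol where "sol P \<longleftrightarrow> bm_posdef (P, 0) \<and> ?F (P, 0) = (P, 0)" for P
  have bm: "bm_posdef P \<and> bm_riccati (0, A\<^sub>2) (0, B\<^sub>2) (Q, 0) (R, 0) P \<longleftrightarrow>
      snd P = 0 \<and> sol (fst P)" for P
    unfolding bm_riccati_iff sol_def
    using bm_ric_antilinear_fixpoint_matrix[OF bmQ(1) bmR(1), of "fst P" "snd P" A\<^sub>2 B\<^sub>2]
    by (cases P) auto
  have anti: "posdef P \<and> anti_riccati A\<^sub>2 B\<^sub>2 Q R P \<longleftrightarrow> sol P" for P
    using anti_riccati_iff_bm_ric[OF _ R] by (auto simp: bm_posdef_matrix sol_def)
  have normal: "posdef P \<and> riccati A\<^sub>N B\<^sub>N Q\<^sub>N R\<^sub>N P \<longleftrightarrow> sol P" for P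
    using riccati_iff_bm_ric[OF _ R\<^sub>N] N_iff_F[of "(P, 0)"] by (auto simp: bm_posdef_matrix sol_def)
  have sol_unique: "P = P'" if "sol P" "sol P'" for P P'
    using that F_unique[of "(P, 0)" "(P', 0)"] by (simp add: sol_def)
  have "(\<exists>!P. snd P = (0 :: complex^'n^'n) \<and> sol (fst P)) \<longleftrightarrow> (\<exists>!P. sol P)"
    using sol_unique by (auto simp: Ex1_def)
  then have bm_iff_anti: "(\<exists>!P. bm_posdef P \<and> bm_riccati (0, A\<^sub>2) (0, B\<^sub>2) (Q, 0) (R, 0) P) \<longleftrightarrow>
      (\<exists>!P\<^sub>A. posdef P\<^sub>A \<and> anti_riccati A\<^sub>2 B\<^sub>2 Q R P\<^sub>A)"
    unfolding bm anti .
  have anti_iff_normal: "(\<exists>!P\<^sub>A. posdef P\<^sub>A \<and> anti_riccati A\<^sub>2 B\<^sub>2 Q R P\<^sub>A) \<longleftrightarrow>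
      (\<exists>!P\<^sub>N. posdef P\<^sub>N \<and> riccati A\<^sub>N B\<^sub>N Q\<^sub>N R\<^sub>N P\<^sub>N)"
    unfolding anti normal ..
  have same: "P\<^sub>2 = 0 \<and> P\<^sub>1 = P\<^sub>A \<and> P\<^sub>A = P\<^sub>N"
    if "bm_posdef (P\<^sub>1, P\<^sub>2)" "bm_riccati (0, A\<^sub>2) (0, B\<^sub>2) (Q, 0) (R, 0) (P\<^sub>1, P\<^sub>2)"
      "posdef P\<^sub>A" "anti_riccati A\<^sub>2 B\<^sub>2 Q R P\<^sub>A" "posdef P\<^sub>N" "riccati A\<^sub>N B\<^sub>N Q\<^sub>N R\<^sub>N P\<^sub>N"
    for P\<^sub>1 P\<^sub>2 P\<^sub>A P\<^sub>N
    using that bm[of "(P\<^sub>1, P\<^sub>2)"] anti[of P\<^sub>A] normal[of P\<^sub>N] sol_unique[of P\<^sub>1 P\<^sub>A] sol_unique[of P\<^sub>A P\<^sub>N] by simp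
  show ?thesis
    by (rule conjI[OF bm_iff_anti conjI[OF anti_iff_normal]], intro impI allI, elim conjE, rule same)
qed

end
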